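(* Let $G$ be a cycle on $n$ vertices (with $n\ge 3$). Then $c_G(\mathfrak m)=n$.
   Context: Let $G$ be a finite simple graph on the vertex set $[n]=\{1,\dots,n\}$, let $K$ be a field, $S=K[x_1,\dots,x_n,y_1,\dots,y_n]$ and $\mathfrak m=(x_1,\dots,x_n,y_1,\dots,y_n)$. The binomial edge ideal of $G$ is $J_G=(x_iy_j-x_jy_i : \{i,j\}\in E(G))\subset S$. For a positive integer $k$ put $\mathfrak m^{[k]}=(x_1^k,\dots,x_n^k,y_1^k,\dots,y_n^k)$, $(\mathfrak m^{[k]},J_G)=\mathfrak m^{[k]}+J_G$, $v_G(k)=\max\{r\in\mathbb N : \mathfrak m^r\not\subseteq(\mathfrak m^{[k]},J_G)\}$, and $c_G(\mathfrak m)=\lim_{k\to\infty} v_G(k)/k$ (the diagonal $F$-threshold of $S/J_G$). *)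

theory Defs
  imports Complex_Main "HOL-Library.Poly_Mapping" "HOL-Algebra.Ideal_Product"
begin

text \<open>A finite simple graph on \<open>{1..n}\<close> is represented by its set of edges.\<close>

definition simple_graph :: "nat \<Rightarrow> nat set set \<Rightarrow> bool" where
  "simple_graph n E \<longleftrightarrow> (\<forall>e\<in>E. e \<subseteq> {1..n} \<and> card e = 2)"

text \<open>The vertices are listed around the cycle as \<open>f 0, \<dots>, f (n - 1)\<close>. For \<open>n < 3\<close> the
  definition does not give a cycle, so uses of it have to assume \<open>n \<ge> 3\<close>.\<close>

definition is_cycle :: "nat \<Rightarrow> nat set set \<Rightarrow> bool" where
  "is_cycle n E \<longleftrightarrow>
     (\<exists>f. bij_betw f {0..<n} {1..n} \<and> E = {{f i, f ((i + 1) mod n)} | i. i < n})"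

datatype var = X nat | Y nat

definition vars_upto :: "nat \<Rightarrow> var set" where
  "vars_upto n = X ` {1..n} \<union> Y ` {1..n}"

text \<open>A monomial is a finitely supported exponent function \<^typ>\<open>var \<Rightarrow>\<^sub>0 nat\<close>; the
  multiplication of \<^typ>\<open>(var \<Rightarrow>\<^sub>0 nat) \<Rightarrow>\<^sub>0 'k::field\<close> is the convolution product, so this type is
  the polynomial ring in all variables \<open>X i, Y i\<close> (\<open>i\<close> any natural number).\<close>

type_synonym 'k mpoly = "(var \<Rightarrow>\<^sub>0 nat) \<Rightarrow>\<^sub>0 'k"

definition poly_var :: "var \<Rightarrow> 'k::field mpoly" where
  "poly_var v = Poly_Mapping.single (Poly_Mapping.single v 1) 1"

text \<open>\<open>K[x\<^sub>1,\<dots>,x\<^sub>n,y\<^sub>1,\<dots>,y\<^sub>n]\<close>\<close>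

definition poly_ring :: "nat \<Rightarrow> 'k::field mpoly ring" where
  "poly_ring n = \<lparr>carrier = {p. \<forall>m\<in>Poly_Mapping.keys p. Poly_Mapping.keys m \<subseteq> vars_upto n},
                  mult = (*), one = 1, zero = 0, add = (+)\<rparr>"

lemma cring_poly_ring: "cring (poly_ring n :: 'k::field mpoly ring)"
proof -
  define C where "C = {p :: 'k mpoly. \<forall>m\<in>Poly_Mapping.keys p. Poly_Mapping.keys m \<subseteq> vars_upto n}"
  have ring_eq: "poly_ring n = \<lparr>carrier = C, mult = (*), one = 1, zero = 0, add = (+)\<rparr>"
    unfolding poly_ring_def C_def ..
  have add: "p + q \<in> C" if "p \<in> C" "q \<in> C" for p q
    using that keys_add[of p q] unfolding C_def by blast
  have mult: "p * q \<in> C" if "p \<in> C" "q \<in> C" for p q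
    unfolding C_def
  proof (intro CollectI ballI)
    fix m assume "m \<in> Poly_Mapping.keys (p * q)"
    then obtain a b where "m = a + b" "a \<in> Poly_Mapping.keys p" "b \<in> Poly_Mapping.keys q"
      using keys_mult[of p q] by blast
    then show "Poly_Mapping.keys m \<subseteq> vars_upto n"
      using that keys_add[of a b] unfolding C_def by blast
  qed
  have uminus: "- p \<in> C" if "p \<in> C" for p
    using that by (simp add: in_keys_iff C_def)
  have zero: "0 \<in> C" and one: "1 \<in> C"
    by (simp_all add: C_def)
  show ?thesis
    unfolding ring_eq
  proof (rule cringI)
    show "abelian_group \<lparr>carrier = C, mult = (*), one = 1, zero = 0, add = (+)\<rparr>"
    proof (rule abelian_groupI, goal_cases)
      case (6 p)
      then show ?case using uminus[of p] by (intro bexI[of _ "- p"]) simp_all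
    qed (simp_all add: add zero add.assoc add.commute)
    show "comm_monoid \<lparr>carrier = C, mult = (*), one = 1, zero = 0, add = (+)\<rparr>"
      by (rule comm_monoidI) (simp_all add: mult one mult.assoc mult.commute)
  qed (simp add: distrib_right)
qed

definition max_ideal :: "nat \<Rightarrow> 'k::field mpoly set" where
  "max_ideal n = Idl\<^bsub>poly_ring n\<^esub> (poly_var ` vars_upto n)"

definition frob_power :: "nat \<Rightarrow> nat \<Rightarrow> 'k::field mpoly set" where
  "frob_power n k = Idl\<^bsub>poly_ring n\<^esub> ((\<lambda>v. poly_var v ^ k) ` vars_upto n)"

text \<open>Each edge contributes its binomial for both orderings of its ends; these differ only by
  sign, so the generated ideal is the same.\<close>

definition binomial_edge_ideal :: "nat \<Rightarrow> nat set set \<Rightarrow> 'k::field mpoly set" where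
  "binomial_edge_ideal n E = Idl\<^bsub>poly_ring n\<^esub>
     {poly_var (X i) * poly_var (Y j) - poly_var (X j) * poly_var (Y i) | i j. {i, j} \<in> E}"

text \<open>The power \<open>\<mm>\<^sup>r\<close> is taken in the multiplicative monoid of ideals of the polynomial ring. For
  \<open>k \<ge> 1\<close> the set below contains \<open>0\<close> and is finite, so \<^const>\<open>Max\<close> is the genuine maximum.
  The argument of type \<^typ>\<open>'k::field itself\<close> names the coefficient field.\<close>

definition v_num :: "'k::field itself \<Rightarrow> nat \<Rightarrow> nat set set \<Rightarrow> nat \<Rightarrow> nat" where
  "v_num _ n E k = Max {r :: nat.
     \<not> (max_ideal n :: 'k mpoly set) [^]\<^bsub>ideals_set (poly_ring n)\<^esub> r
         \<subseteq> frob_power n k <+>\<^bsub>poly_ring n\<^esub> binomial_edge_ideal n E}"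

definition diag_F_threshold :: "'k::field itself \<Rightarrow> nat \<Rightarrow> nat set set \<Rightarrow> real" where
  "diag_F_threshold K n E = lim (\<lambda>k. real (v_num K n E k) / real k)"

end

(* Write a_i for the degree of a monomial in x_i and y_i together. If the total degree exceeds
   n (k - 1), averaging over the n edges of the cycle yields an edge {i, j} with
   a_i + a_j >= 2 k - 1, say a_i >= k, and then the x-degrees or the y-degrees at i and j add up
   to at least k. The binomial of the edge allows swapping an x at j with a y at i, and so the
   monomial is congruent to a multiple of x_i^k (or, symmetrically, of y_i^k).
   Conversely x_1^(k-1) ... x_n^(k-1) does not lie in the monomial ideal generated by all y_i and
   all x_i^k, which contains the ideal in question. Hence v_G(k) = n (k - 1) for all k >= 1. *)

theory Submission
  imports Defs
begin

section \<open>Arithmetic and ideal membership in the polynomial ring\<close>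

abbreviation monom :: "(var \<Rightarrow>\<^sub>0 nat) \<Rightarrow> 'k::field mpoly" where
  "monom m \<equiv> Poly_Mapping.single m 1"

lemma poly_ring_simps [simp]:
  "carrier (poly_ring n) = {p. \<forall>m\<in>Poly_Mapping.keys p. Poly_Mapping.keys m \<subseteq> vars_upto n}"
  "p \<otimes>\<^bsub>poly_ring n\<^esub> q = p * q"
  "p \<oplus>\<^bsub>poly_ring n\<^esub> q = p + q"
  "\<zero>\<^bsub>poly_ring n\<^esub> = 0"
  "\<one>\<^bsub>poly_ring n\<^esub> = 1"
  by (simp_all add: poly_ring_def)

lemma ring_poly_ring: "ring (poly_ring n :: 'k::field mpoly ring)"
  using cring_poly_ring by (rule cring.axioms)

lemma finite_vars_upto [simp]: "finite (vars_upto n)"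
  by (simp add: vars_upto_def)

lemma poly_var_in_carrier: "v \<in> vars_upto n \<Longrightarrow> poly_var v \<in> carrier (poly_ring n)"
  by (simp add: poly_var_def)

lemma poly_var_power: "poly_var v ^ k = monom (Poly_Mapping.single v k)"
  by (induction k) (simp_all add: poly_var_def mult_single flip: single_add)

lemma monom_mult: "monom (m + m') = monom m * monom m'"
  by (simp add: mult_single)

lemma single_eq_const_mult_monom: "Poly_Mapping.single m c = Poly_Mapping.single 0 c * monom m"
  by (simp add: mult_single)

lemma ideal_add_closed:
  assumes "ideal I (poly_ring n)" "p \<in> I" "q \<in> I"
  shows "p + q \<in> I"
  using additive_subgroup.a_closed[OF ideal.axioms(1)[OF assms(1)] assms(2,3)] by simp

lemma ideal_zero_closed:
  assumes "ideal I (poly_ring n)"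
  shows "0 \<in> I"
  using additive_subgroup.zero_closed[OF ideal.axioms(1)[OF assms]] by simp

lemma ideal_mult_closed:
  assumes "ideal I (poly_ring n)" "p \<in> I" "q \<in> carrier (poly_ring n)"
  shows "q * p \<in> I"
  using ideal.I_l_closed[OF assms] by simp

lemma poly_mapping_eq_sum_single:
  "p = (\<Sum>m\<in>Poly_Mapping.keys p. Poly_Mapping.single m (Poly_Mapping.lookup p m))"
proof (rule poly_mapping_eqI)
  fix m
  show "Poly_Mapping.lookup p m =
    Poly_Mapping.lookup (\<Sum>m\<in>Poly_Mapping.keys p. Poly_Mapping.single m (Poly_Mapping.lookup p m)) m"
    by (simp add: lookup_sum lookup_single when_def sum.delta in_keys_iff)
qed

text \<open>A polynomial is the finite sum of its terms, and each term is a constant times a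
  monomial. This reduces inclusions into an arbitrary ideal to single monomials.\<close>

lemma ideal_memI_monoms:
  fixes p :: "'k::field mpoly"
  assumes I: "ideal I (poly_ring n)" and "\<And>m. m \<in> Poly_Mapping.keys p \<Longrightarrow> monom m \<in> I"
  shows "p \<in> I"
proof -
  have "(\<Sum>m\<in>M. Poly_Mapping.single m (Poly_Mapping.lookup p m)) \<in> I"
    if "finite M" "M \<subseteq> Poly_Mapping.keys p" for M
    using that
  proof (induction M rule: finite_induct)
    case empty
    then show ?case using ideal_zero_closed[OF I] by simp
  next
    case (insert m M)
    have "Poly_Mapping.single m (Poly_Mapping.lookup p m) \<in> I"
      unfolding single_eq_const_mult_monom[of m "Poly_Mapping.lookup p m"]
      using insert.prems assms(2)[of m] by (intro ideal_mult_closed[OF I]) auto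
    then show ?case using insert by (simp add: ideal_add_closed[OF I])
  qed
  then have "(\<Sum>m\<in>Poly_Mapping.keys p. Poly_Mapping.single m (Poly_Mapping.lookup p m)) \<in> I"
    by simp
  then show ?thesis by (simp only: flip: poly_mapping_eq_sum_single)
qed

subsection \<open>Monomial ideals\<close>

text \<open>A predicate on exponents replaces a list of generators. The set is an ideal once
  \<open>P\<close> is closed under adding exponents, that is, under taking multiples of monomials.
  It is used for a degree bound and for the ideal that separates off the witness of the lower
  bound.\<close>

definition monomial_ideal :: "nat \<Rightarrow> ((var \<Rightarrow>\<^sub>0 nat) \<Rightarrow> bool) \<Rightarrow> 'k::field mpoly set" where
  "monomial_ideal n P = {p \<in> carrier (poly_ring n). \<forall>m\<in>Poly_Mapping.keys p. P m}"

lemma ideal_monomial_ideal: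
  assumes P: "\<And>m m'. P m \<Longrightarrow> P (m + m')"
  shows "ideal (monomial_ideal n P :: 'k::field mpoly set) (poly_ring n)"
proof -
  interpret R: cring "poly_ring n :: 'k mpoly ring" by (rule cring_poly_ring)
  let ?I = "monomial_ideal n P :: 'k mpoly set"
  have mult: "q * p \<in> ?I" if "p \<in> ?I" "q \<in> carrier (poly_ring n)" for p q
    unfolding monomial_ideal_def
  proof (intro CollectI conjI ballI)
    show "q * p \<in> carrier (poly_ring n)"
      using R.m_closed[of q p] that unfolding monomial_ideal_def poly_ring_simps(2) by blast
  next
    fix m assume "m \<in> Poly_Mapping.keys (q * p)"
    then obtain a b where "m = a + b" "b \<in> Poly_Mapping.keys p"
      using keys_mult[of q p] by blast
    then show "P m" using that P[of b a] unfolding monomial_ideal_def by (simp add: add.commute)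
  qed
  show ?thesis
  proof (rule idealI[OF ring_poly_ring])
    show "subgroup ?I (add_monoid (poly_ring n))"
    proof (rule subgroup.intro)
      fix p q assume pq: "p \<in> ?I" "q \<in> ?I"
      have "p + q \<in> carrier (poly_ring n)"
        using R.a_closed[of p q] pq unfolding monomial_ideal_def poly_ring_simps(3) by blast
      then show "p \<otimes>\<^bsub>add_monoid (poly_ring n)\<^esub> q \<in> ?I"
        using pq keys_add[of p q] unfolding monomial_ideal_def by auto
    next
      fix p assume p: "p \<in> ?I"
      \<comment> \<open>The ring record carries no subtraction of its own; uniqueness of additive
        inverses identifies its inverse with \<open>- p\<close>.\<close>
      then have "\<ominus>\<^bsub>poly_ring n\<^esub> p = - p"
        by (intro R.minus_equality) (auto simp: monomial_ideal_def)
      then show "inv\<^bsub>add_monoid (poly_ring n)\<^esub> p \<in> ?I"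
        using p by (simp add: a_inv_def monomial_ideal_def)
    qed (auto simp: monomial_ideal_def)
  qed (use mult in \<open>auto simp: mult.commute\<close>)
qed

definition total_degree :: "nat \<Rightarrow> (var \<Rightarrow>\<^sub>0 nat) \<Rightarrow> nat" where
  "total_degree n m = (\<Sum>v\<in>vars_upto n. Poly_Mapping.lookup m v)"

lemma total_degree_add: "total_degree n (m + m') = total_degree n m + total_degree n m'"
  by (simp add: total_degree_def lookup_add sum.distrib)

lemma total_degree_single: "v \<in> vars_upto n \<Longrightarrow> total_degree n (Poly_Mapping.single v k) = k"
  by (simp add: total_degree_def lookup_single when_def)

lemma total_degree_eq_sum:
  "total_degree n m =
    (\<Sum>i\<in>{1..n}. Poly_Mapping.lookup m (X i) + Poly_Mapping.lookup m (Y i))"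
proof -
  have "total_degree n m =
      sum (Poly_Mapping.lookup m) (X ` {1..n}) + sum (Poly_Mapping.lookup m) (Y ` {1..n})"
    unfolding total_degree_def vars_upto_def by (rule sum.union_disjoint) auto
  then show ?thesis by (simp add: sum.reindex inj_on_def sum.distrib)
qed

subsection \<open>Powers of the maximal ideal\<close>

lemma ideals_set_nat_pow_Suc:
  "I [^]\<^bsub>ideals_set R\<^esub> (Suc r) = ideal_prod R (I [^]\<^bsub>ideals_set R\<^esub> r) I"
  by (simp add: nat_pow_def ideals_set_def)

lemma one_ideals_set: "\<one>\<^bsub>ideals_set R\<^esub> = carrier R"
  by (simp add: ideals_set_def)

lemma poly_var_in_max_ideal:
  "v \<in> vars_upto n \<Longrightarrow> poly_var v \<in> (max_ideal n :: 'k::field mpoly set)"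
  unfolding max_ideal_def
  using ring.genideal_self[OF ring_poly_ring, of "poly_var ` vars_upto n" n] poly_var_in_carrier
  by blast

text \<open>Each generator of the maximal ideal has degree 1, and degrees add up when monomials are
  multiplied.\<close>

lemma max_ideal_pow_subset:
  "(max_ideal n :: 'k::field mpoly set) [^]\<^bsub>ideals_set (poly_ring n)\<^esub> r
    \<subseteq> monomial_ideal n (\<lambda>m. r \<le> total_degree n m)"
proof (induction r)
  case 0
  then show ?case by (simp add: one_ideals_set monomial_ideal_def)
next
  case (Suc r)
  let ?D = "\<lambda>r. monomial_ideal n (\<lambda>m. r \<le> total_degree n m) :: 'k mpoly set"
  have D: "ideal (?D r) (poly_ring n)" for r
    by (rule ideal_monomial_ideal) (simp add: total_degree_add)
  have max: "max_ideal n \<subseteq> ?D 1"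
    unfolding max_ideal_def
    by (rule ring.genideal_minimal[OF ring_poly_ring D])
      (auto simp: monomial_ideal_def poly_var_def total_degree_single)
  show ?case
  proof
    fix p assume "p \<in> (max_ideal n :: 'k mpoly set) [^]\<^bsub>ideals_set (poly_ring n)\<^esub> (Suc r)"
    then have "p \<in> ideal_prod (poly_ring n)
        ((max_ideal n :: 'k mpoly set) [^]\<^bsub>ideals_set (poly_ring n)\<^esub> r) (max_ideal n)"
      by (simp only: ideals_set_nat_pow_Suc)
    \<comment> \<open>The product ideal is built inductively from products by sums, so the degree
      bound has to be checked on these two only.\<close>
    then show "p \<in> ?D (Suc r)"
    proof (induction p rule: ideal_prod.induct)
      case (prod p q)
      then have pq: "p \<in> ?D r" "q \<in> ?D 1" using Suc.IH max by blast+
      have "Suc r \<le> total_degree n m" if "m \<in> Poly_Mapping.keys (p * q)" for m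
      proof -
        obtain a b where ab: "m = a + b" "a \<in> Poly_Mapping.keys p" "b \<in> Poly_Mapping.keys q"
          using keys_mult[of p q] \<open>m \<in> _\<close> by blast
        then have "r \<le> total_degree n a" "1 \<le> total_degree n b"
          using pq by (auto simp: monomial_ideal_def)
        then show ?thesis using ab by (simp add: total_degree_add)
      qed
      moreover have "p * q \<in> carrier (poly_ring n)"
        using pq cring.cring_simprules(5)[OF cring_poly_ring, of p n q]
        unfolding monomial_ideal_def poly_ring_simps(2) by blast
      ultimately show ?case unfolding monomial_ideal_def by simp
    next
      case (sum p q)
      then show ?case using ideal_add_closed[OF D] by simp
    qed
  qed
qed

text \<open>Peel off one variable at a time; each contributes one factor from the maximal
  ideal.\<close>

lemma monom_in_max_ideal_pow:
  assumes "Poly_Mapping.keys m \<subseteq> vars_upto n"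
  shows "monom m \<in> (max_ideal n :: 'k::field mpoly set)
    [^]\<^bsub>ideals_set (poly_ring n)\<^esub> (total_degree n m)"
  using assms
proof (induction "total_degree n m" arbitrary: m)
  case 0
  then show ?case by (simp flip: 0(1) add: one_ideals_set)
next
  case (Suc r)
  then obtain v where v: "v \<in> vars_upto n" "Poly_Mapping.lookup m v \<noteq> 0"
    unfolding total_degree_def by (metis nat.distinct(1) sum.neutral)
  \<comment> \<open>Subtraction of exponents is truncated; it is exact here because \<open>v\<close>
    has a nonzero exponent in \<open>m\<close>.\<close>
  define m' where "m' = m - Poly_Mapping.single v 1"
  have m: "m = m' + Poly_Mapping.single v 1"
    by (rule poly_mapping_eqI)
      (use v in \<open>auto simp: m'_def lookup_add lookup_minus lookup_single when_def\<close>)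
  have "Poly_Mapping.keys m' \<subseteq> vars_upto n"
    using Suc.prems by (auto simp: m'_def in_keys_iff lookup_minus)
  moreover have r: "r = total_degree n m'"
    using Suc.hyps(2) v by (simp add: m total_degree_add total_degree_single)
  ultimately have "monom m' * poly_var v \<in> ideal_prod (poly_ring n)
      ((max_ideal n :: 'k mpoly set) [^]\<^bsub>ideals_set (poly_ring n)\<^esub> r) (max_ideal n)"
    by (intro ideal_prod.prod[where R = "poly_ring n", unfolded poly_ring_simps]
        poly_var_in_max_ideal[OF v(1)]) (simp add: Suc.hyps(1))
  moreover have "monom m' * poly_var v = (monom m :: 'k mpoly)"
    by (simp add: m poly_var_def mult_single)
  ultimately show ?case by (simp only: ideals_set_nat_pow_Suc flip: Suc.hyps(2))
qed

subsection \<open>Membership of monomials\<close>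

lemma monom_mem_if_power:
  assumes I: "ideal I (poly_ring n)" and "poly_var a ^ k \<in> (I :: 'k::field mpoly set)"
    and "Poly_Mapping.keys m \<subseteq> vars_upto n" "k \<le> Poly_Mapping.lookup m a"
  shows "monom m \<in> I"
proof -
  define m' where "m' = m - Poly_Mapping.single a k"
  have m: "m = m' + Poly_Mapping.single a k"
    by (rule poly_mapping_eqI)
      (use assms(4) in \<open>auto simp: m'_def lookup_add lookup_minus lookup_single when_def\<close>)
  have "Poly_Mapping.keys m' \<subseteq> vars_upto n"
    using assms(3) by (auto simp: m'_def in_keys_iff lookup_minus)
  then have "monom m' * poly_var a ^ k \<in> I"
    by (intro ideal_mult_closed[OF I assms(2)]) simp
  then show ?thesis by (simp add: poly_var_power m mult_single)
qed

text \<open>Modulo the binomial, a factor \<open>c b\<close> of the monomial may be traded for \<open>a d\<close>, which raises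
  the exponent of \<open>a\<close>. The two degree conditions guarantee that \<open>b\<close> and \<open>c\<close> do not run out
  before \<open>a\<close> has exponent \<open>k\<close>.\<close>

lemma monom_mem_if_exchange:
  assumes I: "ideal I (poly_ring n)" and pow: "poly_var a ^ k \<in> (I :: 'k::field mpoly set)"
    and bin: "poly_var c * poly_var b - poly_var a * poly_var d \<in> I"
    and vars: "a \<in> vars_upto n" "d \<in> vars_upto n"
    and ne: "a \<noteq> b" "a \<noteq> c" "b \<noteq> c"
    and "Poly_Mapping.keys m \<subseteq> vars_upto n"
    and "k \<le> Poly_Mapping.lookup m a + Poly_Mapping.lookup m b"
    and "k \<le> Poly_Mapping.lookup m a + Poly_Mapping.lookup m c"
  shows "monom m \<in> I"
  using assms(9-)
proof (induction "k - Poly_Mapping.lookup m a" arbitrary: m rule: less_induct)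
  case less
  show ?case
  proof (cases "k \<le> Poly_Mapping.lookup m a")
    case True
    then show ?thesis using monom_mem_if_power[OF I pow] less.prems by blast
  next
    case False
    \<comment> \<open>The exponent of \<open>a\<close> is still below \<open>k\<close>, so the two
      degree conditions force \<open>b\<close> and \<open>c\<close> to divide the monomial. Hence
      both subtractions are exact.\<close>
    define m0 where "m0 = m - Poly_Mapping.single b 1 - Poly_Mapping.single c 1"
    define m1 where "m1 = m0 + (Poly_Mapping.single a 1 + Poly_Mapping.single d 1)"
    have m: "m = m0 + (Poly_Mapping.single c 1 + Poly_Mapping.single b 1)"
      by (rule poly_mapping_eqI)
        (use False less.prems ne in
          \<open>auto simp: m0_def lookup_add lookup_minus lookup_single when_def\<close>)
    have m0: "Poly_Mapping.keys m0 \<subseteq> vars_upto n"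
      using less.prems(1) by (auto simp: m0_def in_keys_iff lookup_minus)
    have m1: "Poly_Mapping.keys m1 \<subseteq> vars_upto n"
    proof
      fix v assume "v \<in> Poly_Mapping.keys m1"
      then have "v \<in> Poly_Mapping.keys m0 \<or> v = a \<or> v = d"
        by (auto simp: m1_def in_keys_iff lookup_add lookup_single when_def split: if_splits)
      then show "v \<in> vars_upto n" using m0 vars by blast
    qed
    \<comment> \<open>The exchange costs one \<open>b\<close> and one \<open>c\<close> but gains at
      least one \<open>a\<close>, so neither degree condition is lost and the distance of the
      exponent of \<open>a\<close> from \<open>k\<close> shrinks. The variable \<open>d\<close> may
      coincide with any of the others.\<close>
    have "monom m1 \<in> I"
    proof (rule less.hyps[OF _ m1])
      show "k - Poly_Mapping.lookup m1 a < k - Poly_Mapping.lookup m a"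
        using False ne by (simp add: m m1_def lookup_add lookup_single)
      show "k \<le> Poly_Mapping.lookup m1 a + Poly_Mapping.lookup m1 b"
        "k \<le> Poly_Mapping.lookup m1 a + Poly_Mapping.lookup m1 c"
        using less.prems(2,3) ne by (simp_all add: m m1_def lookup_add lookup_single)
    qed
    moreover have "monom m0 * (poly_var c * poly_var b - poly_var a * poly_var d) \<in> I"
      by (rule ideal_mult_closed[OF I bin]) (use m0 in simp)
    ultimately have
      "monom m0 * (poly_var c * poly_var b - poly_var a * poly_var d) + monom m1 \<in> I"
      using ideal_add_closed[OF I] by blast
    then show ?thesis
      by (simp add: m m1_def monom_mult right_diff_distrib poly_var_def)
  qed
qed

text \<open>Four exponents with sum at least \<open>2 * k - 1\<close> cannot have both their x-part
  and their y-part below \<open>k\<close>. A large x-part lets the exchange collect powers of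
  \<open>X i\<close>, a large y-part powers of \<open>Y i\<close>. The bound is stated with
  \<open>Suc\<close> to avoid truncated subtraction.\<close>

lemma monom_mem_if_edge:
  fixes I :: "'k::field mpoly set"
  assumes I: "ideal I (poly_ring n)"
    and frob: "\<And>v. v \<in> vars_upto n \<Longrightarrow> poly_var v ^ k \<in> I"
    and edge: "poly_var (X i) * poly_var (Y j) - poly_var (X j) * poly_var (Y i) \<in> I"
      "poly_var (X j) * poly_var (Y i) - poly_var (X i) * poly_var (Y j) \<in> I"
    and ij: "i \<in> {1..n}" "j \<in> {1..n}" "i \<noteq> j"
    and m: "Poly_Mapping.keys m \<subseteq> vars_upto n"
    and deg: "k \<le> Poly_Mapping.lookup m (X i) + Poly_Mapping.lookup m (Y i)"
      "2 * k \<le> Suc (Poly_Mapping.lookup m (X i) + Poly_Mapping.lookup m (Y i)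
        + (Poly_Mapping.lookup m (X j) + Poly_Mapping.lookup m (Y j)))"
  shows "monom m \<in> I"
proof -
  have vars: "X i \<in> vars_upto n" "X j \<in> vars_upto n" "Y i \<in> vars_upto n" "Y j \<in> vars_upto n"
    using ij by (auto simp: vars_upto_def)
  consider "k \<le> Poly_Mapping.lookup m (X i) + Poly_Mapping.lookup m (X j)"
    | "k \<le> Poly_Mapping.lookup m (Y i) + Poly_Mapping.lookup m (Y j)"
    using deg(2) by linarith
  then show ?thesis
  proof cases
    case 1
    then show ?thesis
      using monom_mem_if_exchange[OF I frob edge(2), of m] vars ij m deg(1) by simp
  next
    case 2
    \<comment> \<open>This is the first edge binomial reordered to fit the exchange with
      \<open>a\<close>, \<open>b\<close>, \<open>c\<close>, \<open>d\<close> equal to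
      \<open>Y i\<close>, \<open>X i\<close>, \<open>Y j\<close>, \<open>X j\<close>.\<close>
    have "poly_var (Y j) * poly_var (X i) - poly_var (Y i) * poly_var (X j) \<in> I"
      using edge(1) by (simp add: mult.commute)
    from monom_mem_if_exchange[OF I frob this, of m] show ?thesis
      using 2 vars ij m deg(1) by (simp add: add.commute)
  qed
qed

section \<open>Averaging degrees around the cycle\<close>

lemma sum_cyclic_shift:
  fixes g :: "nat \<Rightarrow> nat"
  shows "(\<Sum>i<n. g ((i + 1) mod n)) = (\<Sum>i<n. g i)"
proof (cases n)
  case (Suc l)
  \<comment> \<open>The reduction modulo \<open>n\<close> only affects the last index, which wraps
    around to 0.\<close>
  have "(\<Sum>i<n. g ((i + 1) mod n)) = (\<Sum>i<l. g (Suc i)) + g 0"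
    by (simp add: Suc)
  also have "\<dots> = (\<Sum>i<n. g i)"
    unfolding Suc sum.lessThan_Suc_shift by simp
  finally show ?thesis .
qed simp

text \<open>Summing \<open>g\<close> over the two ends of all \<open>n\<close> consecutive pairs
  counts every vertex twice. If every pair had weight at most \<open>2 * (k - 1)\<close>, the total
  weight would be at most \<open>n * (k - 1)\<close>.\<close>

lemma exists_heavy_cycle_edge:
  fixes g :: "nat \<Rightarrow> nat"
  assumes "is_cycle n E" and "n * (k - 1) < (\<Sum>i\<in>{1..n}. g i)"
  obtains i j where "{i, j} \<in> E" "2 * k \<le> Suc (g i + g j)"
proof -
  obtain f where f: "bij_betw f {0..<n} {1..n}"
    and E: "E = {{f i, f ((i + 1) mod n)} | i. i < n}"
    using assms(1) unfolding is_cycle_def by blast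
  have sum: "(\<Sum>i<n. g (f i)) = (\<Sum>i\<in>{1..n}. g i)"
    using sum.reindex_bij_betw[OF f, of g] by (simp add: lessThan_atLeast0)
  have "\<exists>i<n. 2 * (k - 1) < g (f i) + g (f ((i + 1) mod n))"
  proof (rule ccontr)
    assume "\<not> ?thesis"
    then have "(\<Sum>i<n. g (f i) + g (f ((i + 1) mod n))) \<le> (\<Sum>i<n. 2 * (k - 1))"
      by (intro sum_mono) (metis lessThan_iff not_less)
    then show False
      using assms(2) sum_cyclic_shift[of "\<lambda>i. g (f i)" n] by (simp add: sum.distrib sum)
  qed
  then obtain i where "i < n" "2 * (k - 1) < g (f i) + g (f ((i + 1) mod n))" by blast
  moreover from this have "{f i, f ((i + 1) mod n)} \<in> E" using E by blast
  ultimately show ?thesis using that by simp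
qed

subsection \<open>The ideal of a cycle\<close>

lemma frob_gens_in_carrier: "(\<lambda>v. poly_var v ^ k) ` vars_upto n \<subseteq> carrier (poly_ring n)"
  by (auto simp: poly_var_power split: if_splits)

lemma edge_gens_in_carrier:
  assumes "simple_graph n E"
  shows "{poly_var (X i) * poly_var (Y j) - poly_var (X j) * poly_var (Y i) | i j. {i, j} \<in> E}
    \<subseteq> carrier (poly_ring n :: 'k::field mpoly ring)"
proof clarify
  fix i j assume "{i, j} \<in> E"
  then have "i \<in> {1..n}" "j \<in> {1..n}" using assms unfolding simple_graph_def by blast+
  then have "Poly_Mapping.keys (Poly_Mapping.single (X i) 1 + Poly_Mapping.single (Y j) (1::nat))
      \<subseteq> vars_upto n"
    "Poly_Mapping.keys (Poly_Mapping.single (X j) 1 + Poly_Mapping.single (Y i) (1::nat))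
      \<subseteq> vars_upto n"
    by (intro order_trans[OF keys_add]; auto simp: vars_upto_def)+
  then show "poly_var (X i) * poly_var (Y j) - poly_var (X j) * poly_var (Y i)
      \<in> carrier (poly_ring n :: 'k mpoly ring)"
    unfolding poly_ring_simps(1) poly_var_def mult_single
    by (auto dest!: subsetD[OF keys_diff] split: if_splits)
qed

lemma ideal_frob_power: "ideal (frob_power n k :: 'k::field mpoly set) (poly_ring n)"
  unfolding frob_power_def
  by (rule ring.genideal_ideal[OF ring_poly_ring frob_gens_in_carrier])

lemma ideal_binomial_edge_ideal:
  "simple_graph n E \<Longrightarrow> ideal (binomial_edge_ideal n E :: 'k::field mpoly set) (poly_ring n)"
  unfolding binomial_edge_ideal_def
  by (rule ring.genideal_ideal[OF ring_poly_ring edge_gens_in_carrier])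

lemma subset_set_add:
  assumes "ideal I (poly_ring n)" "ideal J (poly_ring n)"
  shows "I \<union> J \<subseteq> I <+>\<^bsub>poly_ring n\<^esub> J"
proof -
  have "p + q \<in> I <+>\<^bsub>poly_ring n\<^esub> J" if "p \<in> I" "q \<in> J" for p q
    using that by (auto simp: set_add_def')
  from this[OF _ ideal_zero_closed[OF assms(2)]] this[OF ideal_zero_closed[OF assms(1)]]
  show ?thesis by auto
qed

lemma max_ideal_pow_subset_cycle:
  assumes simple: "simple_graph n E" and cycle: "is_cycle n E" and r: "n * (k - 1) < r"
  shows "(max_ideal n :: 'k::field mpoly set) [^]\<^bsub>ideals_set (poly_ring n)\<^esub> r
    \<subseteq> frob_power n k <+>\<^bsub>poly_ring n\<^esub> binomial_edge_ideal n E"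
    (is "_ \<subseteq> ?I")
proof
  fix p :: "'k mpoly"
  assume "p \<in> max_ideal n [^]\<^bsub>ideals_set (poly_ring n)\<^esub> r"
  then have p: "p \<in> monomial_ideal n (\<lambda>m. r \<le> total_degree n m)"
    using max_ideal_pow_subset by blast
  have I: "ideal ?I (poly_ring n)"
    by (rule ring.add_ideals[OF ring_poly_ring ideal_frob_power
          ideal_binomial_edge_ideal[OF simple]])
  have sub: "frob_power n k \<union> binomial_edge_ideal n E \<subseteq> ?I"
    by (rule subset_set_add[OF ideal_frob_power ideal_binomial_edge_ideal[OF simple]])
  have frob: "poly_var v ^ k \<in> ?I" if "v \<in> vars_upto n" for v
    using that sub ring.genideal_self[OF ring_poly_ring frob_gens_in_carrier]
    unfolding frob_power_def by blast
  have edge: "poly_var (X i) * poly_var (Y j) - poly_var (X j) * poly_var (Y i) \<in> ?I"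
    if "{i, j} \<in> E" for i j
    using that sub ring.genideal_self[OF ring_poly_ring edge_gens_in_carrier[OF simple]]
    unfolding binomial_edge_ideal_def by blast
  show "p \<in> ?I"
  proof (rule ideal_memI_monoms[OF I])
    fix m assume m_key: "m \<in> Poly_Mapping.keys p"
    let ?g = "\<lambda>i. Poly_Mapping.lookup m (X i) + Poly_Mapping.lookup m (Y i)"
    have m: "Poly_Mapping.keys m \<subseteq> vars_upto n" and "r \<le> total_degree n m"
      using m_key p by (auto simp: monomial_ideal_def)
    then have "n * (k - 1) < (\<Sum>i\<in>{1..n}. ?g i)"
      using r by (simp add: total_degree_eq_sum)
    then obtain i j where ij: "{i, j} \<in> E" "2 * k \<le> Suc (?g i + ?g j)"
      using exists_heavy_cycle_edge[OF cycle] by blast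
    \<comment> \<open>Edges have exactly two elements, which rules out \<open>i = j\<close>.\<close>
    have ij': "i \<in> {1..n}" "j \<in> {1..n}" "i \<noteq> j"
      using ij(1) simple unfolding simple_graph_def by fastforce+
    have ji: "{j, i} \<in> E" using ij(1) by (simp add: insert_commute)
    \<comment> \<open>Two integers below \<open>k\<close> add up to at most
      \<open>2 * k - 2\<close>, so one end has degree at least \<open>k\<close>. That end takes the
      role of \<open>i\<close> in \<open>monom_mem_if_edge\<close>.\<close>
    consider "k \<le> ?g i" | "k \<le> ?g j" using ij(2) by linarith
    then show "monom m \<in> ?I"
    proof cases
      case 1
      then show ?thesis
        using monom_mem_if_edge[OF I frob edge[OF ij(1)] edge[OF ji], of m] ij' m ij(2) by simp
    next
      case 2
      then show ?thesis
        using monom_mem_if_edge[OF I frob edge[OF ji] edge[OF ij(1)], of m] ij' m ij(2)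
        by (simp add: add.commute)
    qed
  qed
qed

text \<open>The sum of the two ideals is enclosed in a monomial ideal, where membership of a
  monomial can be read off from its exponents.\<close>

lemma max_ideal_pow_not_subset:
  assumes simple: "simple_graph n E" and k: "k \<ge> 1"
  shows "\<not> (max_ideal n :: 'k::field mpoly set) [^]\<^bsub>ideals_set (poly_ring n)\<^esub> (n * (k - 1))
    \<subseteq> frob_power n k <+>\<^bsub>poly_ring n\<^esub> binomial_edge_ideal n E"
proof
  assume sub: "(max_ideal n :: 'k mpoly set) [^]\<^bsub>ideals_set (poly_ring n)\<^esub> (n * (k - 1))
    \<subseteq> frob_power n k <+>\<^bsub>poly_ring n\<^esub> binomial_edge_ideal n E"
  \<comment> \<open>Divisibility by some \<open>Y i\<close> or by some \<open>X i\<close> to the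
    power \<open>k\<close>.\<close>
  define P where "P = (\<lambda>m. \<exists>i. Poly_Mapping.lookup m (Y i) \<noteq> 0
    \<or> k \<le> Poly_Mapping.lookup m (X i))"
  have P: "ideal (monomial_ideal n P :: 'k mpoly set) (poly_ring n)"
    by (rule ideal_monomial_ideal) (auto simp: P_def lookup_add intro: trans_le_add1)
  have "(\<lambda>v. poly_var v ^ k) ` vars_upto n \<subseteq> (monomial_ideal n P :: 'k mpoly set)"
  proof clarify
    fix v assume v: "v \<in> vars_upto n"
    \<comment> \<open>For a \<open>Y\<close> variable this uses \<open>k \<ge> 1\<close>: its zeroth
      power would be 1.\<close>
    have "P (Poly_Mapping.single v k)"
      using k unfolding P_def by (cases v) (metis lookup_single_eq order_refl not_one_le_zero)+
    then show "poly_var v ^ k \<in> (monomial_ideal n P :: 'k mpoly set)"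
      using v by (simp add: monomial_ideal_def poly_var_power)
  qed
  then have frob: "frob_power n k \<subseteq> (monomial_ideal n P :: 'k mpoly set)"
    unfolding frob_power_def by (rule ring.genideal_minimal[OF ring_poly_ring P])
  \<comment> \<open>Both terms of an edge binomial contain a \<open>Y\<close> variable, whichever
    edge it comes from.\<close>
  have "P m" if "m \<in> Poly_Mapping.keys
      (poly_var (X i) * poly_var (Y j) - poly_var (X j) * poly_var (Y i) :: 'k mpoly)" for m i j
  proof -
    have "m = Poly_Mapping.single (X i) 1 + Poly_Mapping.single (Y j) 1
        \<or> m = Poly_Mapping.single (X j) 1 + Poly_Mapping.single (Y i) 1"
      using subsetD[OF keys_diff that] by (auto simp: poly_var_def mult_single)
    then show ?thesis
      unfolding P_def by (metis add_is_0 lookup_add lookup_single_eq one_neq_zero)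
  qed
  then have "{poly_var (X i) * poly_var (Y j) - poly_var (X j) * poly_var (Y i) | i j. {i, j} \<in> E}
      \<subseteq> (monomial_ideal n P :: 'k mpoly set)"
    using edge_gens_in_carrier[OF simple] unfolding monomial_ideal_def by blast
  then have "binomial_edge_ideal n E \<subseteq> (monomial_ideal n P :: 'k mpoly set)"
    unfolding binomial_edge_ideal_def by (rule ring.genideal_minimal[OF ring_poly_ring P])
  with frob have I: "frob_power n k <+>\<^bsub>poly_ring n\<^esub> binomial_edge_ideal n E
      \<subseteq> (monomial_ideal n P :: 'k mpoly set)"
    by (auto simp: set_add_def' intro!: ideal_add_closed[OF P])
  \<comment> \<open>Every \<open>X i\<close> gets the largest exponent that \<open>P\<close> does
    not detect, and no \<open>Y\<close> occurs; the degree is then exactly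
    \<open>n * (k - 1)\<close>.\<close>
  define m where "m = (\<Sum>i\<in>{1..n}. Poly_Mapping.single (X i) (k - 1))"
  have lookup: "Poly_Mapping.lookup m (X i) = (if i \<in> {1..n} then k - 1 else 0)"
    "Poly_Mapping.lookup m (Y i) = 0" for i
    by (simp_all add: m_def lookup_sum lookup_single when_def sum.delta)
  have keys: "Poly_Mapping.keys m \<subseteq> vars_upto n"
  proof
    fix v assume "v \<in> Poly_Mapping.keys m"
    then show "v \<in> vars_upto n"
      by (cases v) (auto simp: in_keys_iff lookup vars_upto_def split: if_splits)
  qed
  have "total_degree n m = n * (k - 1)"
    by (simp add: total_degree_eq_sum lookup)
  then have "monom m \<in> (monomial_ideal n P :: 'k mpoly set)"
    using monom_in_max_ideal_pow[OF keys] sub I by auto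
  then have "P m" by (simp add: monomial_ideal_def)
  then show False using k by (auto simp: P_def lookup split: if_splits)
qed

section \<open>The exact value of \<open>v_num\<close> and its growth rate\<close>

lemma v_num_cycle:
  assumes "simple_graph n E" "is_cycle n E" "k \<ge> 1"
  shows "v_num TYPE('k::field) n E k = n * (k - 1)"
  unfolding v_num_def
proof (rule Max_eqI)
  let ?S = "{r :: nat. \<not> (max_ideal n :: 'k mpoly set) [^]\<^bsub>ideals_set (poly_ring n)\<^esub> r
    \<subseteq> frob_power n k <+>\<^bsub>poly_ring n\<^esub> binomial_edge_ideal n E}"
  show "r \<le> n * (k - 1)" if "r \<in> ?S" for r
    using that max_ideal_pow_subset_cycle[OF assms(1,2), of k r] not_less by blast
  \<comment> \<open>The upper bound also yields finiteness, without which \<open>Max\<close> would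
    not be a genuine maximum.\<close>
  then show "finite ?S"
    unfolding finite_nat_set_iff_bounded_le by blast
qed (use max_ideal_pow_not_subset[OF assms(1,3)] in simp)

theorem theorem2p6:
  fixes n :: nat and E :: "nat set set"
  assumes "n \<ge> 3"
    and "simple_graph n E"
    and "is_cycle n E"
  shows "convergent (\<lambda>k. real (v_num TYPE('k::field) n E k) / real k) \<and>
         diag_F_threshold TYPE('k::field) n E = real n"
proof -
  have "(\<lambda>k. real n - real n / real k) \<longlonglongrightarrow> real n - 0"
    by (intro tendsto_intros lim_const_over_n)
  \<comment> \<open>The two sequences agree from \<open>k = 1\<close> on. At \<open>k = 0\<close>
    division by zero gives 0, so the left side is \<open>n\<close> while the right side is
    0.\<close>
  moreover have "\<forall>\<^sub>F k in sequentially.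
      real n - real n / real k = real (v_num TYPE('k) n E k) / real k"
    using eventually_ge_at_top[of 1]
    by eventually_elim (simp add: v_num_cycle[OF assms(2,3)] of_nat_diff field_simps)
  ultimately have "(\<lambda>k. real (v_num TYPE('k) n E k) / real k) \<longlonglongrightarrow> real n"
    using tendsto_cong by fastforce
  then show ?thesis
    unfolding diag_F_threshold_def by (auto intro: convergentI limI)
qed

end
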